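(* Let $I,X,Y$ be nonempty sets, $\mathbf C$ a nonempty set of functions $I\to X$, $\Omega$ a nonempty set of functions $I\to Y$, and $\mathcal X$ a nonempty family of subsets of $I$. Let $\mathbf M=\mathcal P(\mathbf C)^{\Omega}$, and define $\mathcal F:\mathbf M\to\mathcal P(\mathbf M)$ by $$\mathcal F(\phi)=\prod_{\omega\in\Omega}\mathcal P\Bigl(\bigcap_{A\in\mathcal X}\ \bigcup_{\substack{h\in\mathbf C\\ h|_A\in[\phi](-\omega|A)}}\mathbf C(h|A)\Bigr),\qquad\phi\in\mathbf M.$$ Then $\mathcal F$ unlocks the predicate "be an $\mathcal X$-non-anticipating mapping" on $\mathbf M$, i.e. for every $\phi\in\mathbf M$: $\phi\in\mathcal F(\phi)$ if and only if $\phi$ is $\mathcal X$-non-anticipating.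
   Context: $\mathcal P(Z)$ is the power set of $Z$; $\mathbf M$ is the set of all multifunctions $\phi:\Omega\to\mathcal P(\mathbf C)$, and a product $\prod_{\omega\in\Omega}\mathcal P(S_\omega)$ with $S_\omega\subset\mathbf C$ is identified with $\{\psi\in\mathbf M\mid\psi(\omega)\subset S_\omega\ \forall\omega\in\Omega\}$. For a function $f$ on $I$ and $A\subset I$, $f|_A$ is its restriction to $A$; for a set $F$ of functions on $I$, $(F|A)=\{f|_A: f\in F\}$. For $\omega\in\Omega$, $H\subset\mathbf C$, $h\in\mathbf C$: $\Omega(\omega|A)=\{\nu\in\Omega\mid\nu|_A=\omega|_A\}$, $\Omega(-\omega|A)=\Omega(\omega|A)\setminus\{\omega\}$, $H(h|A)=\{f\in H\mid f|_A=h|_A\}$. For $\phi\in\mathbf M$, $[\phi](-\omega|A)=\bigcap_{\nu\in\Omega(-\omega|A)}(\phi(\nu)|A)$, where the intersection over the empty index set is taken to be $(\mathbf C|A)$. A multifunction $\phi\in\mathbf M$ is $\mathcal X$-non-anticipating iff for all $A\in\mathcal X$ and $\omega,\omega'\in\Omega$ with $\omega'|_A=\omega|_A$ one has $(\phi(\omega)|A)\subset(\phi(\omega')|A)$. *)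

theory Defs
  imports "HOL-Library.FuncSet"
begin

(* A function on a set I is represented as in HOL-Library.FuncSet: it takes the value
   "undefined" outside I.  So equality of restrictions "restrict f A = restrict g A" is
   equality of the restricted functions. *)

(* (F|A) *)
definition restr_set :: "('i \<Rightarrow> 'v) set \<Rightarrow> 'i set \<Rightarrow> ('i \<Rightarrow> 'v) set" where
  "restr_set F A = (\<lambda>f. restrict f A) ` F"

(* C(h|A) and Omega(\<omega>|A) *)
definition agreeing :: "('i \<Rightarrow> 'v) set \<Rightarrow> ('i \<Rightarrow> 'v) \<Rightarrow> 'i set \<Rightarrow> ('i \<Rightarrow> 'v) set" where
  "agreeing H h A = {f \<in> H. restrict f A = restrict h A}"

(* Omega(-\<omega>|A) *)
definition agreeing_others ::
    "('i \<Rightarrow> 'v) set \<Rightarrow> ('i \<Rightarrow> 'v) \<Rightarrow> 'i set \<Rightarrow> ('i \<Rightarrow> 'v) set" where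
  "agreeing_others H h A = agreeing H h A - {h}"

definition multifunctions ::
    "('i \<Rightarrow> 'y) set \<Rightarrow> ('i \<Rightarrow> 'x) set \<Rightarrow> (('i \<Rightarrow> 'y) \<Rightarrow> ('i \<Rightarrow> 'x) set) set" where
  "multifunctions \<Omega> C = (\<Omega> \<rightarrow>\<^sub>E Pow C)"

(* [\<phi>](-\<omega>|A); the empty intersection is (C|A) by convention, not the whole type. *)
definition common_restr ::
    "('i \<Rightarrow> 'y) set \<Rightarrow> ('i \<Rightarrow> 'x) set \<Rightarrow> (('i \<Rightarrow> 'y) \<Rightarrow> ('i \<Rightarrow> 'x) set) \<Rightarrow>
     ('i \<Rightarrow> 'y) \<Rightarrow> 'i set \<Rightarrow> ('i \<Rightarrow> 'x) set" where
  "common_restr \<Omega> C \<phi> \<omega> A =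
     (if agreeing_others \<Omega> \<omega> A = {} then restr_set C A
      else \<Inter>\<nu>\<in>agreeing_others \<Omega> \<omega> A. restr_set (\<phi> \<nu>) A)"

definition non_anticipating ::
    "('i \<Rightarrow> 'y) set \<Rightarrow> 'i set set \<Rightarrow> (('i \<Rightarrow> 'y) \<Rightarrow> ('i \<Rightarrow> 'x) set) \<Rightarrow> bool" where
  "non_anticipating \<Omega> \<X> \<phi> \<longleftrightarrow>
     (\<forall>A\<in>\<X>. \<forall>\<omega>\<in>\<Omega>. \<forall>\<omega>'\<in>\<Omega>. restrict \<omega>' A = restrict \<omega> A \<longrightarrow>
        restr_set (\<phi> \<omega>) A \<subseteq> restr_set (\<phi> \<omega>') A)"

definition unlocking_map ::
    "('i \<Rightarrow> 'y) set \<Rightarrow> ('i \<Rightarrow> 'x) set \<Rightarrow> 'i set set \<Rightarrow>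
     (('i \<Rightarrow> 'y) \<Rightarrow> ('i \<Rightarrow> 'x) set) \<Rightarrow> (('i \<Rightarrow> 'y) \<Rightarrow> ('i \<Rightarrow> 'x) set) set" where
  "unlocking_map \<Omega> C \<X> \<phi> =
     (\<Pi>\<^sub>E \<omega>\<in>\<Omega>. Pow (\<Inter>A\<in>\<X>. \<Union>h\<in>{h \<in> C. restrict h A \<in> common_restr \<Omega> C \<phi> \<omega> A}. agreeing C h A))"

lemma unlocking_map_in_Pow:
  assumes "\<X> \<noteq> {}"
  shows "unlocking_map \<Omega> C \<X> \<in> multifunctions \<Omega> C \<rightarrow> Pow (multifunctions \<Omega> C)"
proof -
  have "(\<Inter>A\<in>\<X>. \<Union>h\<in>{h \<in> C. restrict h A \<in> common_restr \<Omega> C \<phi> \<omega> A}. agreeing C h A) \<subseteq> C"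
    for \<phi> \<omega>
    using assms by (auto simp: agreeing_def)
  then show ?thesis
    unfolding unlocking_map_def multifunctions_def by (intro funcsetI PowI PiE_mono Pow_mono)
qed

definition unlocks :: "('m \<Rightarrow> 'm set) \<Rightarrow> ('m \<Rightarrow> bool) \<Rightarrow> 'm set \<Rightarrow> bool" where
  "unlocks F P M \<longleftrightarrow> (\<forall>\<phi>\<in>M. \<phi> \<in> F \<phi> \<longleftrightarrow> P \<phi>)"

end

theory Submission
  imports Defs
begin

text \<open>
  The union over \<open>h\<close> of the classes \<open>C(h|A)\<close> is a disguised restriction condition: a function
  \<open>f \<in> C\<close> lies in it iff \<open>f\<close> itself satisfies the condition imposed on \<open>h\<close>, because \<open>f\<close> and \<open>h\<close>
  agree on \<open>A\<close> and the condition only sees the values on \<open>A\<close>. Hence \<open>\<phi>\<close> is a fixed point of the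
  unlocking map iff \<open>(\<phi>(\<omega>)|A) \<subseteq> [\<phi>](-\<omega>|A)\<close> for all \<open>\<omega>\<close> and \<open>A\<close>, and this says that
  \<open>(\<phi>(\<omega>)|A) \<subseteq> (\<phi>(\<nu>)|A)\<close> for every \<open>\<nu> \<noteq> \<omega>\<close> that agrees with \<open>\<omega>\<close> on \<open>A\<close>. This is non-anticipation:
  leaving out \<open>\<nu> = \<omega>\<close> only drops a trivial inclusion.
\<close>

text \<open>For the inclusion from right to left, \<open>f\<close> serves as its own witness \<open>h\<close>.\<close>

lemma Union_agreeing_eq:
  "(\<Union>h\<in>{h \<in> C. restrict h A \<in> R}. agreeing C h A) = {f \<in> C. restrict f A \<in> R}"
  by (auto simp: agreeing_def)

text \<open>
  The case to watch is an input \<open>\<omega>\<close> with which no other input agrees on \<open>A\<close>: the right-hand side is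
  vacuous, while by the convention for the empty intersection the left-hand side becomes
  \<open>(S|A) \<subseteq> (C|A)\<close>, which is where \<open>S \<subseteq> C\<close> enters.
\<close>

lemma restr_set_subset_common_restr_iff:
  assumes "S \<subseteq> C"
  shows "restr_set S A \<subseteq> common_restr \<Omega> C \<phi> \<omega> A \<longleftrightarrow>
    (\<forall>\<nu>\<in>agreeing_others \<Omega> \<omega> A. restr_set S A \<subseteq> restr_set (\<phi> \<nu>) A)"
proof (cases "agreeing_others \<Omega> \<omega> A = {}")
  case True
  then show ?thesis
    using assms by (auto simp: common_restr_def restr_set_def)
next
  case False
  then show ?thesis
    by (simp add: common_restr_def le_INF_iff)
qed

lemma mem_unlocking_map_iff:
  assumes "\<phi> \<in> multifunctions \<Omega> C"
  shows "\<phi> \<in> unlocking_map \<Omega> C \<X> \<phi> \<longleftrightarrow>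
    (\<forall>\<omega>\<in>\<Omega>. \<forall>A\<in>\<X>. restr_set (\<phi> \<omega>) A \<subseteq> common_restr \<Omega> C \<phi> \<omega> A)"
proof -
  have "\<phi> \<in> extensional \<Omega>"
    using assms by (simp add: multifunctions_def PiE_def)
  then have "\<phi> \<in> unlocking_map \<Omega> C \<X> \<phi> \<longleftrightarrow>
    (\<forall>\<omega>\<in>\<Omega>. \<forall>A\<in>\<X>. \<phi> \<omega> \<subseteq> {f \<in> C. restrict f A \<in> common_restr \<Omega> C \<phi> \<omega> A})"
    unfolding unlocking_map_def Union_agreeing_eq PiE_iff Pow_iff le_INF_iff by simp
  also have "\<dots> \<longleftrightarrow> (\<forall>\<omega>\<in>\<Omega>. \<forall>A\<in>\<X>. restr_set (\<phi> \<omega>) A \<subseteq> common_restr \<Omega> C \<phi> \<omega> A)"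
  proof (intro ball_cong refl)
    fix \<omega> A assume "\<omega> \<in> \<Omega>"
    then have "\<phi> \<omega> \<subseteq> C"
      using assms by (auto simp: multifunctions_def)
    then show "\<phi> \<omega> \<subseteq> {f \<in> C. restrict f A \<in> common_restr \<Omega> C \<phi> \<omega> A} \<longleftrightarrow>
        restr_set (\<phi> \<omega>) A \<subseteq> common_restr \<Omega> C \<phi> \<omega> A"
      unfolding restr_set_def image_subset_iff by blast
  qed
  finally show ?thesis .
qed

lemma non_anticipating_iff_others:
  "non_anticipating \<Omega> \<X> \<phi> \<longleftrightarrow>
    (\<forall>\<omega>\<in>\<Omega>. \<forall>A\<in>\<X>. \<forall>\<nu>\<in>agreeing_others \<Omega> \<omega> A. restr_set (\<phi> \<omega>) A \<subseteq> restr_set (\<phi> \<nu>) A)"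
proof -
  have "(\<forall>\<omega>'\<in>\<Omega>. restrict \<omega>' A = restrict \<omega> A \<longrightarrow> restr_set (\<phi> \<omega>) A \<subseteq> restr_set (\<phi> \<omega>') A) \<longleftrightarrow>
    (\<forall>\<nu>\<in>agreeing_others \<Omega> \<omega> A. restr_set (\<phi> \<omega>) A \<subseteq> restr_set (\<phi> \<nu>) A)" for \<omega> A
    by (auto simp: agreeing_others_def agreeing_def)
  then show ?thesis
    unfolding non_anticipating_def by blast
qed

theorem mainTheorem7:
  fixes I :: "'i set" and X :: "'x set" and Y :: "'y set"
    and C :: "('i \<Rightarrow> 'x) set" and \<Omega> :: "('i \<Rightarrow> 'y) set" and \<X> :: "'i set set"
  assumes "I \<noteq> {}" and "X \<noteq> {}" and "Y \<noteq> {}"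
    and "C \<noteq> {}" and "C \<subseteq> (I \<rightarrow>\<^sub>E X)"
    and "\<Omega> \<noteq> {}" and "\<Omega> \<subseteq> (I \<rightarrow>\<^sub>E Y)"
    and "\<X> \<noteq> {}" and "\<X> \<subseteq> Pow I"
  shows "unlocks (unlocking_map \<Omega> C \<X>) (non_anticipating \<Omega> \<X>) (multifunctions \<Omega> C)"
  unfolding unlocks_def
proof
  fix \<phi> assume \<phi>: "\<phi> \<in> multifunctions \<Omega> C"
  then have "\<phi> \<omega> \<subseteq> C" if "\<omega> \<in> \<Omega>" for \<omega>
    using that by (auto simp: multifunctions_def)
  then show "\<phi> \<in> unlocking_map \<Omega> C \<X> \<phi> \<longleftrightarrow> non_anticipating \<Omega> \<X> \<phi>"
    unfolding mem_unlocking_map_iff[OF \<phi>] non_anticipating_iff_others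
    by (simp add: restr_set_subset_common_restr_iff)
qed

end
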